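(* Let $\mathbb{F}$ be a field and let $m,n\ge 1$. Let $f_1,\ldots,f_m\in\mathbb{F}\langle X_1,\ldots,X_n\rangle$ be $M_s(\mathbb{F})$-locally linearly dependent for some positive integer $s$ with $$s>\frac12\Big(\sum_{j=1}^m\deg(f_j)+m-1\Big).$$ Then $f_1,\ldots,f_m$ are linearly dependent in $\mathbb{F}\langle X_1,\ldots,X_n\rangle$ over $\mathbb{F}$.
   Context: $\mathbb{F}$ is an arbitrary field. $\mathbb{F}\langle X_1,\ldots,X_n\rangle$ is the free associative unital $\mathbb{F}$-algebra (polynomials in noncommuting variables), and $\deg$ is the total degree, i.e. the maximal length of a word occurring with nonzero coefficient. $M_s(\mathbb{F})$ is the algebra of $s\times s$ matrices over $\mathbb{F}$. For $p\in\mathbb{F}\langle X_1,\ldots,X_n\rangle$ and $A\in M_s(\mathbb{F})^n$, $p(A)\in M_s(\mathbb{F})$ is the evaluation of $p$ at $X_i=A_i$ (the empty word evaluates to the identity matrix). Polynomials $f_1,\ldots,f_m$ are $M_s(\mathbb{F})$-locally linearly dependent if for every $A\in M_s(\mathbb{F})^n$ the matrices $f_1(A),\ldots,f_m(A)$ are linearly dependent over $\mathbb{F}$, i.e. there are $\alpha_1,\ldots,\alpha_m\in\mathbb{F}$ (possibly depending on $A$), not all zero, with $\sum_j\alpha_j f_j(A)=0$. *)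

theory Defs
  imports "HOL-Analysis.Analysis" "HOL-Library.Poly_Mapping"
begin

text \<open>
  The free monoid of words over \<open>'v\<close>, written additively: with this instance the convolution
  product on finitely supported functions is the product of the free algebra, the word with no
  letters being its unit.
\<close>

datatype 'v nc_word = NC_Word (letters: "'v list")

instantiation nc_word :: (type) monoid_add
begin

definition zero_nc_word :: "'a nc_word"
  where "zero_nc_word = NC_Word []"

definition plus_nc_word :: "'a nc_word \<Rightarrow> 'a nc_word \<Rightarrow> 'a nc_word"
  where "plus_nc_word u v = NC_Word (letters u @ letters v)"

instance
  by standard (simp_all add: zero_nc_word_def plus_nc_word_def)

end

type_synonym ('v, 'a) free_algebra = "'v nc_word \<Rightarrow>\<^sub>0 'a"

definition fa_scale :: "'a::field \<Rightarrow> ('v, 'a) free_algebra \<Rightarrow> ('v, 'a) free_algebra"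
  where "fa_scale c p = Poly_Mapping.map (\<lambda>x. c * x) p"

text \<open>The zero polynomial gets degree 0.\<close>

definition fa_degree :: "('v, 'a::field) free_algebra \<Rightarrow> nat"
  where "fa_degree p = Max (insert 0 ((\<lambda>w. length (letters w)) ` Poly_Mapping.keys p))"

definition mat_scale :: "'a::field \<Rightarrow> 'a ^ 's ^ 's \<Rightarrow> 'a ^ 's ^ 's"
  where "mat_scale c M = (\<chi> i j. c * M $ i $ j)"

text \<open>The class multiplication on \<open>'a ^ 's ^ 's\<close> is entrywise; the matrix product is \<open>**\<close>.\<close>

definition word_eval :: "('v \<Rightarrow> 'a::field ^ 's::finite ^ 's) \<Rightarrow> 'v nc_word \<Rightarrow> 'a ^ 's ^ 's"
  where "word_eval A w = foldr (\<lambda>i M. A i ** M) (letters w) (mat 1)"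

definition fa_eval :: "('v \<Rightarrow> 'a::field ^ 's::finite ^ 's) \<Rightarrow> ('v, 'a) free_algebra \<Rightarrow> 'a ^ 's ^ 's"
  where "fa_eval A p =
    (\<Sum>w\<in>Poly_Mapping.keys p. mat_scale (Poly_Mapping.lookup p w) (word_eval A w))"

text \<open>
  Linear dependence of a family, not of the set of its values: repeated members make it dependent.
\<close>

definition family_dependent ::
    "('a::field \<Rightarrow> 'b \<Rightarrow> 'b) \<Rightarrow> 'i set \<Rightarrow> ('i \<Rightarrow> 'b::comm_monoid_add) \<Rightarrow> bool"
  where "family_dependent smul I v \<longleftrightarrow>
    (\<exists>\<alpha>. (\<exists>j\<in>I. \<alpha> j \<noteq> 0) \<and> (\<Sum>j\<in>I. smul (\<alpha> j) (v j)) = 0)"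

text \<open>The size of the matrices is passed as the type \<open>'s\<close>.\<close>

definition locally_dependent ::
    "'s::finite itself \<Rightarrow> 'i set \<Rightarrow> ('i \<Rightarrow> ('v, 'a::field) free_algebra) \<Rightarrow> bool"
  where "locally_dependent (_ :: 's itself) I f \<longleftrightarrow>
    (\<forall>A :: 'v \<Rightarrow> 'a ^ 's ^ 's. family_dependent mat_scale I (\<lambda>j. fa_eval A (f j)))"

end

theory Submission
  imports Defs
begin

text \<open>
  Let \<open>W\<close> be the span of the polynomials \<open>f\<^sub>j\<close>. The proof constructs one tuple \<open>A\<close> of \<open>s \<times> s\<close> matrices
  with entries 0 and 1 such that no nonzero element of \<open>W\<close> vanishes at \<open>A\<close>. A local dependence at this
  \<open>A\<close> is then a dependence of the polynomials themselves.

  A variant of Gaussian elimination gives words \<open>w\<^sub>1, \<dots>, w\<^sub>r\<close> whose coefficients determine the elements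
  of \<open>W\<close>: \<open>w\<^sub>1\<close> is a longest word that occurs in \<open>W\<close>, \<open>w\<^sub>2\<close> a longest word that occurs in the subspace
  where the coefficient of \<open>w\<^sub>1\<close> vanishes, and so on. Each elimination step uses up one generator whose
  degree is the length of the word and does not raise the other degrees, so the sum of the numbers
  \<open>|w\<^sub>i| + 1\<close> is at most the sum of the numbers \<open>deg f\<^sub>j + 1\<close> (\<open>leading_words_span\<close>), and hence at most
  \<open>2s\<close>.

  The matrices come from the matrix units in the proof that \<open>M\<^sub>s\<close> has no polynomial identity of degree
  below \<open>2s\<close>: the units with indices 00, 01, 11, 12, 22, and so on, form a staircase of \<open>2s - 1\<close> steps, and
  distinct ones have a nonzero product only in increasing order. The
  words \<open>w\<^sub>1, \<dots>, w\<^sub>r\<close> are laid out along the staircase, in disjoint segments with one free step between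
  two neighbours; this needs one step fewer than the sum of the \<open>|w\<^sub>i| + 1\<close>. A set \<open>S\<close> of steps, labelled
  by variables, is turned into matrices by sending each variable to the sum of the units in \<open>S\<close> with
  this label.

  Suppose that \<open>p\<close> has degree at most \<open>|w|\<close>. If \<open>S\<close> runs through the subsets of the segment of \<open>w\<close>,
  then by inclusion and exclusion an alternating sum of the entries of \<open>p\<close>, taken at the two ends of
  the segment, counts only the walks that use every step of the segment. Such a walk of length at
  most \<open>|w|\<close> spells \<open>w\<close>, so the alternating sum is the coefficient of \<open>w\<close> in \<open>p\<close>
  (\<open>coeff_zero_if_segment_entries_zero\<close>). This holds over every field, finite ones included.

  It remains to choose the same subset for all elements of \<open>W\<close> (\<open>separating_steps_exist\<close>). Once subsets
  are chosen for the later segments, the elements of \<open>W\<close> that vanish there form a space on which the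
  coefficient of \<open>w\<close> is injective. It is at most a line, so one subset of the segment of
  \<open>w\<close> that does not kill a generator of that line is enough.
\<close>

section \<open>The free algebra as a vector space\<close>

lemma lookup_fa_scale [simp]:
  "Poly_Mapping.lookup (fa_scale c p) w = c * Poly_Mapping.lookup p w"
  by (simp add: fa_scale_def map.rep_eq when_def)

interpretation fa: vector_space "fa_scale :: 'a::field \<Rightarrow> ('v, 'a) free_algebra \<Rightarrow> _"
  by standard (auto intro!: poly_mapping_eqI simp: lookup_add algebra_simps)

lemma fa_degree_le_iff:
  "fa_degree p \<le> d \<longleftrightarrow> (\<forall>w. Poly_Mapping.lookup p w \<noteq> 0 \<longrightarrow> length (letters w) \<le> d)"
  unfolding fa_degree_def by (subst Max_le_iff) (auto simp: in_keys_iff)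

lemma length_le_fa_degree:
  "Poly_Mapping.lookup p w \<noteq> 0 \<Longrightarrow> length (letters w) \<le> fa_degree p"
  using fa_degree_le_iff by blast

lemma fa_degree_attained:
  assumes "p \<noteq> 0"
  obtains w where "Poly_Mapping.lookup p w \<noteq> 0" and "length (letters w) = fa_degree p"
proof -
  let ?L = "(\<lambda>w. length (letters w)) ` Poly_Mapping.keys p"
  have "?L \<noteq> {}" "finite ?L"
    using assms by auto
  then have "fa_degree p = Max ?L" and "Max ?L \<in> ?L"
    by (simp_all add: fa_degree_def)
  then show ?thesis
    using that by (auto simp: in_keys_iff)
qed

lemma subspace_fa_degree_le:
  "fa.subspace {p :: ('v, 'a::field) free_algebra. fa_degree p \<le> d}"
proof (rule fa.subspaceI)
  fix p q :: "('v, 'a) free_algebra"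
  assume "p \<in> {p. fa_degree p \<le> d}" "q \<in> {p. fa_degree p \<le> d}"
  then show "p + q \<in> {p. fa_degree p \<le> d}"
    by (auto simp: fa_degree_le_iff lookup_add) (metis add.right_neutral)
qed (auto simp: fa_degree_le_iff)

lemma subspace_coeff_zero:
  "fa.subspace {p :: ('v, 'a::field) free_algebra. Poly_Mapping.lookup p w = 0}"
  by (rule fa.subspaceI) (auto simp: lookup_add)

lemma fa_eval_nth:
  "fa_eval A p $ a $ b =
    (\<Sum>w\<in>Poly_Mapping.keys p. Poly_Mapping.lookup p w * word_eval A w $ a $ b)"
  by (simp add: fa_eval_def mat_scale_def)

lemma fa_eval_nth_superset:
  assumes "finite K" "Poly_Mapping.keys p \<subseteq> K"
  shows "fa_eval A p $ a $ b = (\<Sum>w\<in>K. Poly_Mapping.lookup p w * word_eval A w $ a $ b)"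
  unfolding fa_eval_nth using assms
  by (intro sum.mono_neutral_left) (auto simp: in_keys_iff)

lemma fa_eval_scale: "fa_eval A (fa_scale c p) = mat_scale c (fa_eval A p)"
proof -
  have "Poly_Mapping.keys (fa_scale c p) \<subseteq> Poly_Mapping.keys p"
    by (auto simp: in_keys_iff)
  then show ?thesis
    by (simp add: vec_eq_iff mat_scale_def fa_eval_nth_superset[of "Poly_Mapping.keys p"]
        sum_distrib_left mult.assoc)
qed

lemma fa_eval_add: "fa_eval A (p + q) = fa_eval A p + fa_eval A q"
  by (simp add: vec_eq_iff lookup_add distrib_right sum.distrib keys_add
      fa_eval_nth_superset[of "Poly_Mapping.keys p \<union> Poly_Mapping.keys q"])

lemma fa_eval_zero: "fa_eval A 0 = 0"
  by (simp add: fa_eval_def)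

lemma fa_eval_sum: "fa_eval A (\<Sum>j\<in>J. p j) = (\<Sum>j\<in>J. fa_eval A (p j))"
  by (induction J rule: infinite_finite_induct) (simp_all add: fa_eval_zero fa_eval_add)

section \<open>Leading words\<close>

text \<open>
  No word longer than \<open>w\<close> occurs in \<open>W\<close>, and the remaining words play the same role for the subspace
  where the coefficient of \<open>w\<close> vanishes; at the end nothing but 0 is left. Hence an element of \<open>W\<close> is
  determined by its coefficients at the listed words.
\<close>

fun leading_words :: "'v nc_word list \<Rightarrow> ('v, 'a::field) free_algebra set \<Rightarrow> bool" where
  "leading_words [] W \<longleftrightarrow> W \<subseteq> {0}"
| "leading_words (w # ws) W \<longleftrightarrow>
    (\<forall>p\<in>W. fa_degree p \<le> length (letters w)) \<and>
    leading_words ws {p \<in> W. Poly_Mapping.lookup p w = 0}"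

lemma leading_words_mono: "leading_words ws W \<Longrightarrow> V \<subseteq> W \<Longrightarrow> leading_words ws V"
proof (induction ws arbitrary: V W)
  case (Cons w ws)
  have "{p \<in> V. Poly_Mapping.lookup p w = 0} \<subseteq> {p \<in> W. Poly_Mapping.lookup p w = 0}"
    using Cons.prems by auto
  then show ?case
    using Cons by auto
qed auto

text \<open>
  Gaussian elimination with a pivot \<open>f i\<close> of maximal degree and a pivot word \<open>w\<close> of that degree. Only
  generators in which \<open>w\<close> occurs are changed, and these have the degree of the pivot already, so no
  degree goes up. The pivot pays for \<open>w\<close> and the other generators pay for the remaining words.
\<close>

lemma leading_words_span:
  fixes f :: "'i \<Rightarrow> ('v, 'a::field) free_algebra"
  assumes "finite J"
  shows "\<exists>ws. leading_words ws (fa.span (f ` J)) \<and>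
    (\<Sum>w\<leftarrow>ws. length (letters w) + 1) \<le> (\<Sum>j\<in>J. fa_degree (f j) + 1)"
  using assms
proof (induction "card J" arbitrary: J f)
  case 0
  then have "leading_words [] (fa.span (f ` J))"
    by simp
  then show ?case
    by fastforce
next
  case (Suc n)
  show ?case
  proof (cases "\<forall>j\<in>J. f j = 0")
    case True
    then have "fa.span (f ` J) \<subseteq> {0}"
      by (intro fa.span_minimal) auto
    then have "leading_words [] (fa.span (f ` J))"
      by simp
    then show ?thesis
      by fastforce
  next
    case False
    (* The pivot has to be nonzero; among constants the degree alone does not ensure this. *)
    define N where "N = {j\<in>J. f j \<noteq> 0}"
    have "finite ((\<lambda>j. fa_degree (f j)) ` N)" "(\<lambda>j. fa_degree (f j)) ` N \<noteq> {}"
      using False Suc.prems by (auto simp: N_def)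
    then have "Max ((\<lambda>j. fa_degree (f j)) ` N) \<in> (\<lambda>j. fa_degree (f j)) ` N"
      using Max_in by blast
    then obtain i where i: "i \<in> N" "Max ((\<lambda>j. fa_degree (f j)) ` N) = fa_degree (f i)"
      by auto
    have deg_N: "fa_degree (f j) \<le> fa_degree (f i)" if "j \<in> N" for j
      using that Suc.prems i(2)[symmetric] by (simp add: N_def)
    have deg_le: "fa_degree (f j) \<le> fa_degree (f i)" if "j \<in> J" for j
      using that deg_N[of j] by (cases "f j = 0") (auto simp: N_def fa_degree_def)
    obtain w where w: "Poly_Mapping.lookup (f i) w \<noteq> 0" "length (letters w) = fa_degree (f i)"
      using fa_degree_attained i(1) by (auto simp: N_def)
    define c where "c j = Poly_Mapping.lookup (f j) w / Poly_Mapping.lookup (f i) w" for j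
    define g where "g j = f j - fa_scale (c j) (f i)" for j
    define I where "I = J - {i}"
    have J: "J = insert i I" "finite I" "i \<notin> I" "n = card I"
      using i(1) Suc by (auto simp: I_def N_def)
    have g_coeff: "Poly_Mapping.lookup (g j) w = 0" for j
      using w by (simp add: g_def c_def lookup_minus)
    have g_deg: "fa_degree (g j) \<le> fa_degree (f j)" if "j \<in> I" for j
    proof (cases "Poly_Mapping.lookup (f j) w = 0")
      case True
      then show ?thesis
        by (simp add: g_def c_def)
    next
      case False
      then have "fa_degree (f i) \<le> fa_degree (f j)"
        using length_le_fa_degree w(2) by metis
      then have "f j \<in> {p. fa_degree p \<le> fa_degree (f j)}" "f i \<in> {p. fa_degree p \<le> fa_degree (f j)}"
        by auto
      then have "g j \<in> {p. fa_degree p \<le> fa_degree (f j)}"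
        unfolding g_def
        by (intro fa.subspace_diff fa.subspace_scale subspace_fa_degree_le)
      then show ?thesis
        by simp
    qed
    obtain ws where ws: "leading_words ws (fa.span (g ` I))"
      "(\<Sum>w\<leftarrow>ws. length (letters w) + 1) \<le> (\<Sum>j\<in>I. fa_degree (g j) + 1)"
      using Suc.hyps(1)[OF J(4) J(2)] by blast
    have g_span: "Poly_Mapping.lookup p w = 0" if "p \<in> fa.span (g ` I)" for p
      using fa.span_minimal[OF _ subspace_coeff_zero[of w], of "g ` I"] that g_coeff by blast
    have "fa.span (f ` J) \<subseteq> {p. fa_degree p \<le> length (letters w)}"
      using deg_le w(2) by (intro fa.span_minimal subspace_fa_degree_le) auto
    moreover have "{p \<in> fa.span (f ` J). Poly_Mapping.lookup p w = 0} \<subseteq> fa.span (g ` I)"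
    proof clarify
      fix p
      assume p: "p \<in> fa.span (f ` J)" "Poly_Mapping.lookup p w = 0"
      have "f j \<in> fa.span (insert (f i) (g ` I))" if "j \<in> J" for j
      proof (cases "j = i")
        case False
        then have "g j \<in> fa.span (insert (f i) (g ` I))"
          using that J(1) by (auto intro: fa.span_base)
        moreover have "fa_scale (c j) (f i) \<in> fa.span (insert (f i) (g ` I))"
          by (auto intro: fa.span_base fa.span_scale)
        moreover have "f j = g j + fa_scale (c j) (f i)"
          by (simp add: g_def)
        ultimately show ?thesis
          by (simp only: fa.span_add)
      qed (auto intro: fa.span_base)
      then have "fa.span (f ` J) \<subseteq> fa.span (insert (f i) (g ` I))"
        by (intro fa.span_minimal fa.subspace_span) auto
      then obtain k where k: "p - fa_scale k (f i) \<in> fa.span (g ` I)"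
        using p(1) fa.span_breakdown_eq by blast
      then have "k = 0"
        using g_span[OF k] p(2) w(1) by (simp add: lookup_minus)
      then show "p \<in> fa.span (g ` I)"
        using k by simp
    qed
    ultimately have "leading_words (w # ws) (fa.span (f ` J))"
      using ws(1) leading_words_mono by auto
    moreover have "(\<Sum>w\<leftarrow>w # ws. length (letters w) + 1) \<le> (\<Sum>j\<in>J. fa_degree (f j) + 1)"
    proof -
      have "(\<Sum>j\<in>I. fa_degree (g j) + 1) \<le> (\<Sum>j\<in>I. fa_degree (f j) + 1)"
        using g_deg by (intro sum_mono) simp
      moreover have "(\<Sum>j\<in>J. fa_degree (f j) + 1) = fa_degree (f i) + 1 + (\<Sum>j\<in>I. fa_degree (f j) + 1)"
        unfolding J(1) using J(2,3) by (rule sum.insert)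
      ultimately show ?thesis
        using ws(2) w(2) by (simp only: list.map sum_list.Cons)
    qed
    ultimately show ?thesis
      by blast
  qed
qed

section \<open>Labelled walks along the staircase\<close>

text \<open>
  Step number \<open>t\<close> leads from vertex \<open>t div 2\<close> to vertex \<open>(t + 1) div 2\<close>: the even steps are loops and the
  odd ones go up to the next vertex. A step carries a variable as its label.
\<close>

fun walk :: "nat \<Rightarrow> (nat \<times> 'v) list \<Rightarrow> nat \<Rightarrow> bool" where
  "walk a [] b \<longleftrightarrow> a = b"
| "walk a (s # ss) b \<longleftrightarrow> fst s div 2 = a \<and> walk ((fst s + 1) div 2) ss b"

lemma walk_le: "walk a ss b \<Longrightarrow> a \<le> b"
  by (induction ss arbitrary: a) fastforce+

lemma walk_step_bounds:
  assumes "walk a ss b" "s \<in> set ss"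
  shows "2 * a \<le> fst s" "fst s \<le> 2 * b"
  using assms
proof (induction ss arbitrary: a)
  case (Cons s' ss)
  {
    case 1
    then show ?case
      using Cons.IH(1)[of "(fst s' + 1) div 2"] by auto
  next
    case 2
    then show ?case
      using Cons.IH(2)[of "(fst s' + 1) div 2"] walk_le[of "(fst s' + 1) div 2" ss b] by auto
  }
qed auto

text \<open>
  No step leads to a lower vertex, and a loop left out at a vertex cannot be made up for after the
  upward step.
\<close>

lemma walk_sorted: "walk a ss b \<Longrightarrow> sorted (map fst ss)"
proof (induction ss arbitrary: a)
  case (Cons s ss)
  have "fst s \<le> fst u" if "u \<in> set ss" for u
    using walk_step_bounds(1)[of "(fst s + 1) div 2" ss b u] Cons.prems that by simp
  then show ?case
    using Cons by auto
qed simp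

lemma walk_enumerate: "walk (k div 2) (List.enumerate k w) ((k + length w) div 2)"
proof (induction w arbitrary: k)
  case (Cons x w)
  then show ?case
    using Cons.IH[of "Suc k"] by simp
qed simp

text \<open>
  This is why the staircase singles out one monomial: a walk that is sorted and uses every step, but
  is not longer than the number of steps, has no freedom left.
\<close>

lemma walk_exhausting_steps_unique:
  assumes "set ss = set (List.enumerate k w)" "length ss \<le> length w" "walk a ss b"
  shows "ss = List.enumerate k w"
proof -
  have "card (set ss) = length w"
    by (simp add: assms(1) distinct_card)
  then have "distinct ss"
    using assms(2) card_length[of ss] by (intro card_distinct) simp
  moreover have inj: "inj_on fst (set (List.enumerate k w))"
    using distinct_map[of fst "List.enumerate k w"] by simp
  ultimately have "distinct (map fst ss)"
    using assms(1) by (simp add: distinct_map)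
  then have "map fst ss = map fst (List.enumerate k w)"
    using assms(1) walk_sorted[OF assms(3)]
    by (intro sorted_distinct_set_unique) (simp_all del: map_fst_enumerate, simp)
  then show ?thesis
    using inj assms(1) by (intro map_inj_on[where f = fst]) auto
qed

section \<open>Evaluation at sums of matrix units\<close>

text \<open>
  The sum of the matrix units of the steps in \<open>S\<close> with label \<open>x\<close>, where \<open>e\<close> numbers the rows and columns.
  The step from \<open>e a\<close> to \<open>e b\<close> has number \<open>e a + e b\<close>, because \<open>t\<close> is the sum of \<open>t div 2\<close> and
  \<open>(t + 1) div 2\<close>.
\<close>

definition step_matrix ::
    "('s::finite \<Rightarrow> nat) \<Rightarrow> (nat \<times> 'v) set \<Rightarrow> 'v \<Rightarrow> 'a::field ^ 's ^ 's" where
  "step_matrix e S x =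
    (\<chi> a b. of_bool ((e b = e a \<or> e b = e a + 1) \<and> (e a + e b, x) \<in> S))"

definition walks :: "(nat \<times> 'v) set \<Rightarrow> 'v list \<Rightarrow> nat \<Rightarrow> nat \<Rightarrow> (nat \<times> 'v) list set" where
  "walks S v a b = {ss. set ss \<subseteq> S \<and> map snd ss = v \<and> walk a ss b}"

lemma finite_walks:
  assumes "finite S"
  shows "finite (walks S v a b)"
proof (rule finite_subset)
  show "walks S v a b \<subseteq> {ss. set ss \<subseteq> S \<and> length ss = length v}"
    by (auto simp: walks_def)
qed (use assms in \<open>rule finite_lists_length_eq\<close>)

context
  fixes e :: "'s::finite \<Rightarrow> nat"
  assumes e: "bij_betw e UNIV {..<CARD('s)}"
begin

lemma vertex_eq_iff: "e a = e b \<longleftrightarrow> a = b"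
  using e by (auto simp: bij_betw_def inj_on_def)

lemma vertex_exists:
  assumes "k < CARD('s)"
  obtains a where "e a = k"
  using assms e by (metis (no_types, lifting) bij_betw_iff_bijections lessThan_iff)

text \<open>
  The step matrices are adjacency matrices, and their products count walks. The bound on the steps
  keeps the end of every step inside the matrix.
\<close>

lemma foldr_step_matrix_nth:
  assumes "finite S" "\<forall>s\<in>S. fst s + 1 < 2 * CARD('s)"
  shows "foldr (\<lambda>x M. step_matrix e S x ** M) v (mat 1) $ a $ b =
    (of_nat (card (walks S v (e a) (e b))) :: 'a::field)"
proof (induction v arbitrary: a)
  case Nil
  have "walks S [] (e a) (e b) = (if a = b then {[]} else {})"
    by (auto simp: walks_def vertex_eq_iff)
  then show ?case
    by (simp add: mat_def)
next
  case (Cons x v)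
  define P where "P k \<longleftrightarrow> (e k = e a \<or> e k = e a + 1) \<and> (e a + e k, x) \<in> S" for k
  define C where "C k = (if P k then (#) (e a + e k, x) ` walks S v (e k) (e b) else {})" for k
  have C: "walks S (x # v) (e a) (e b) = (\<Union>k. C k)"
  proof (intro equalityI subsetI)
    fix ss
    assume "ss \<in> walks S (x # v) (e a) (e b)"
    then obtain t ss' where ss: "ss = (t, x) # ss'" "(t, x) \<in> S" "t div 2 = e a"
      "ss' \<in> walks S v ((t + 1) div 2) (e b)"
      by (cases ss) (auto simp: walks_def)
    have "(t + 1) div 2 < CARD('s)"
      using assms(2) ss(2) by fastforce
    then obtain k where k: "e k = (t + 1) div 2"
      using vertex_exists by metis
    have "t = e a + e k"
      using k ss(3) by linarith
    moreover have "e k = e a \<or> e k = e a + 1"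
      using k ss(3) by linarith
    ultimately have "ss \<in> C k"
      using ss k by (auto simp: C_def P_def)
    then show "ss \<in> (\<Union>k. C k)"
      by blast
  next
    fix ss
    assume "ss \<in> (\<Union>k. C k)"
    then obtain k ss' where k: "P k" "ss = (e a + e k, x) # ss'" "ss' \<in> walks S v (e k) (e b)"
      by (auto simp: C_def split: if_splits)
    have "(e a + e k) div 2 = e a" "(e a + e k + 1) div 2 = e k"
      using k(1) by (auto simp: P_def)
    then show "ss \<in> walks S (x # v) (e a) (e b)"
      using k by (auto simp: walks_def P_def)
  qed
  have "card (walks S (x # v) (e a) (e b)) = (\<Sum>k\<in>UNIV. card (C k))"
    unfolding C
  proof (rule card_UN_disjoint)
    show "\<forall>i\<in>UNIV. finite (C i)"
      using finite_walks[OF assms(1)] by (auto simp: C_def)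
    show "\<forall>i\<in>UNIV. \<forall>j\<in>UNIV. i \<noteq> j \<longrightarrow> C i \<inter> C j = {}"
      using vertex_eq_iff by (auto simp: C_def split: if_splits)
  qed simp
  also have "\<dots> = (\<Sum>k\<in>UNIV. of_bool (P k) * card (walks S v (e k) (e b)))"
    by (intro sum.cong) (auto simp: C_def card_image)
  finally have "(of_nat (card (walks S (x # v) (e a) (e b))) :: 'a) =
      (\<Sum>k\<in>UNIV. of_bool (P k) * of_nat (card (walks S v (e k) (e b))))"
    by simp
  moreover have "foldr (\<lambda>x M. step_matrix e S x ** M) (x # v) (mat 1) $ a $ b =
      (\<Sum>k\<in>UNIV. step_matrix e S x $ a $ k *
        foldr (\<lambda>x M. step_matrix e S x ** M) v (mat 1) $ k $ b :: 'a)"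
    by (simp add: matrix_matrix_mult_def)
  ultimately show ?case
    by (simp only: Cons.IH) (simp add: step_matrix_def P_def)
qed

lemma fa_eval_step_matrix_nth:
  assumes "finite S" "\<forall>s\<in>S. fst s + 1 < 2 * CARD('s)"
  shows "fa_eval (step_matrix e S) p $ a $ b =
    (\<Sum>w\<in>Poly_Mapping.keys p. Poly_Mapping.lookup p w * of_nat (card (walks S (letters w) (e a) (e b))))"
  by (simp add: fa_eval_nth word_eval_def foldr_step_matrix_nth[OF assms])

lemma fa_eval_step_matrix_cong:
  assumes "finite S" "\<forall>s\<in>S. fst s + 1 < 2 * CARD('s)"
    and "finite T" "\<forall>s\<in>T. fst s + 1 < 2 * CARD('s)"
    and "\<And>ss. walk (e a) ss (e b) \<Longrightarrow> set ss \<subseteq> S \<longleftrightarrow> set ss \<subseteq> T"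
  shows "fa_eval (step_matrix e S) p $ a $ b = fa_eval (step_matrix e T) p $ a $ b"
proof -
  have "walks S v (e a) (e b) = walks T v (e a) (e b)" for v
    using assms(5) by (auto simp: walks_def)
  then show ?thesis
    by (simp only: fa_eval_step_matrix_nth[OF assms(1,2)] fa_eval_step_matrix_nth[OF assms(3,4)])
qed

text \<open>
  The subsets of a segment together detect the coefficient of \<open>w\<close>. Moebius inversion over these subsets
  replaces the walks inside \<open>S\<close> by the walks that use exactly the steps of \<open>S\<close>, and for the full segment
  there is only one such walk with at most \<open>|w|\<close> steps.
\<close>

lemma coeff_zero_if_segment_entries_zero:
  fixes p :: "('v, 'a::field) free_algebra"
  assumes deg: "fa_degree p \<le> length (letters w)"
    and bound: "k + length (letters w) < 2 * CARD('s)"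
    and a: "e a = k div 2" and b: "e b = (k + length (letters w)) div 2"
    and zero: "\<And>S. S \<subseteq> set (List.enumerate k (letters w)) \<Longrightarrow> fa_eval (step_matrix e S) p $ a $ b = 0"
  shows "Poly_Mapping.lookup p w = 0"
proof -
  let ?X = "set (List.enumerate k (letters w))"
  define exact where "exact S v = {ss. set ss = S \<and> map snd ss = letters v \<and> walk (e a) ss (e b)}"
    for S and v :: "'v nc_word"
  define F where "F S = (\<Sum>v\<in>Poly_Mapping.keys p. Poly_Mapping.lookup p v * of_nat (card (exact S v)))"
    for S
  define G where "G S = (\<Sum>v\<in>Poly_Mapping.keys p.
      Poly_Mapping.lookup p v * of_nat (card (walks S (letters v) (e a) (e b))))" for S
  have G: "G S = sum F (Pow S)" if "finite S" for S
  proof -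
    have "card (walks S (letters v) (e a) (e b)) = (\<Sum>T\<in>Pow S. card (exact T v))" for v
    proof -
      have "walks S (letters v) (e a) (e b) = (\<Union>T\<in>Pow S. exact T v)"
        by (auto simp: walks_def exact_def)
      moreover have "finite (exact T v)" if "T \<subseteq> S" for T
        using finite_walks[OF finite_subset[OF that \<open>finite S\<close>], of "letters v" "e a" "e b"]
        by (rule rev_finite_subset) (auto simp: walks_def exact_def)
      ultimately show ?thesis
        using \<open>finite S\<close> by (simp, subst card_UN_disjoint) (auto simp: exact_def)
    qed
    then have "G S = (\<Sum>v\<in>Poly_Mapping.keys p. \<Sum>T\<in>Pow S.
        Poly_Mapping.lookup p v * of_nat (card (exact T v)))"
      by (simp add: G_def sum_distrib_left)
    also have "\<dots> = sum F (Pow S)"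
      unfolding F_def by (rule sum.swap)
    finally show ?thesis .
  qed
  have G0: "G S = 0" if "S \<subseteq> ?X" for S
  proof -
    have "finite S"
      using that by (rule finite_subset) (rule finite_set)
    moreover have "\<forall>s\<in>S. fst s + 1 < 2 * CARD('s)"
      using that bound by (fastforce simp: in_set_enumerate_eq)
    ultimately show ?thesis
      using zero[OF that] by (simp only: fa_eval_step_matrix_nth G_def)
  qed
  have "F ?X = (\<Sum>T\<in>Pow ?X. (-1) ^ (card ?X - card T) * G T)"
    by (rule inclusion_exclusion_mobius) (simp_all add: G)
  also have "\<dots> = 0"
    using G0 by simp
  finally have "F ?X = 0" .
  moreover have "F ?X = (\<Sum>v\<in>Poly_Mapping.keys p. Poly_Mapping.lookup p v * of_bool (v = w))"
    unfolding F_def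
  proof (intro sum.cong refl)
    fix v
    assume v: "v \<in> Poly_Mapping.keys p"
    then have "length (letters v) \<le> length (letters w)"
      using deg fa_degree_le_iff by (auto simp: in_keys_iff)
    then have *: "ss = List.enumerate k (letters w)" if "ss \<in> exact ?X v" for ss
      using that unfolding exact_def
      by (intro walk_exhausting_steps_unique) (auto dest: arg_cong[where f = length])
    have "exact ?X v = (if v = w then {List.enumerate k (letters w)} else {})"
    proof (cases "v = w")
      case True
      have "List.enumerate k (letters w) \<in> exact ?X w"
        by (simp add: exact_def a b walk_enumerate)
      then show ?thesis
        using True * by auto
    next
      case False
      have "letters v = letters w" if "ss \<in> exact ?X v" for ss
        using *[OF that] that by (auto simp: exact_def)
      then show ?thesis
        using False by (auto simp: nc_word.expand)
    qed
    then show "Poly_Mapping.lookup p v * of_nat (card (exact ?X v)) =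
        Poly_Mapping.lookup p v * of_bool (v = w)"
      by simp
  qed
  ultimately show ?thesis
    by (auto simp: of_bool_def if_distrib in_keys_iff cong: if_cong split: if_splits)
qed

text \<open>
  The segment of the first word starts at step \<open>k\<close>, and the step after it stays unused. This gap makes
  the segments independent: rows from the later part do not see the first segment, and the column at
  the end of the first segment does not see the later steps. The claim therefore only speaks of rows
  from \<open>k div 2\<close> on, which lets the induction proceed from the last segment to the first.
\<close>

lemma separating_steps_exist:
  fixes W :: "('v, 'a::field) free_algebra set"
  assumes "fa.subspace W" "leading_words ws W"
    and "k + (\<Sum>w\<leftarrow>ws. length (letters w) + 1) \<le> 2 * CARD('s)"
  shows "\<exists>S. finite S \<and> (\<forall>s\<in>S. k \<le> fst s \<and> fst s + 1 < 2 * CARD('s)) \<and>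
    (\<forall>p\<in>W. (\<forall>a b. k div 2 \<le> e a \<longrightarrow> fa_eval (step_matrix e S) p $ a $ b = 0) \<longrightarrow> p = 0)"
  using assms
proof (induction ws arbitrary: k W)
  case Nil
  then show ?case
    by (intro exI[of _ "{}"]) auto
next
  case (Cons w ws)
  define l where "l = length (letters w)"
  define V where "V = {p \<in> W. Poly_Mapping.lookup p w = 0}"
  have bound: "k + l < 2 * CARD('s)"
    using Cons.prems(3) by (simp add: l_def)
  have deg: "fa_degree p \<le> l" if "p \<in> W" for p
    using Cons.prems(2) that by (simp add: l_def)
  have V: "fa.subspace V" "leading_words ws V"
    using Cons.prems(1,2) fa.subspace_inter[OF Cons.prems(1) subspace_coeff_zero[of w]]
    by (simp_all add: V_def Int_def)
  have rest: "k + l + 1 + (\<Sum>w\<leftarrow>ws. length (letters w) + 1) \<le> 2 * CARD('s)"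
    using Cons.prems(3) by (simp add: l_def)
  from Cons.IH[OF V rest] obtain T where
    T: "finite T" "\<forall>s\<in>T. k + l + 1 \<le> fst s \<and> fst s + 1 < 2 * CARD('s)" and
    T_sep: "\<forall>p\<in>V. (\<forall>a b. (k + l + 1) div 2 \<le> e a \<longrightarrow>
      fa_eval (step_matrix e T) p $ a $ b = 0) \<longrightarrow> p = 0"
    by (elim exE conjE)
  (* On K the coefficient of w is injective, so K has dimension at most 1. *)
  define K where "K = {p \<in> W. \<forall>a b. (k + l + 1) div 2 \<le> e a \<longrightarrow>
      fa_eval (step_matrix e T) p $ a $ b = 0}"
  have K: "fa.subspace K"
    using Cons.prems(1) unfolding K_def fa.subspace_def
    by (auto simp: fa_eval_zero fa_eval_add fa_eval_scale mat_scale_def)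
  have K_coeff: "p = 0" if "p \<in> K" "Poly_Mapping.lookup p w = 0" for p
    using bspec[OF T_sep, of p] that by (simp add: K_def V_def)
  have "k div 2 < CARD('s)" "(k + l) div 2 < CARD('s)"
    using bound by linarith+
  then obtain a b where a: "e a = k div 2" and b: "e b = (k + l) div 2"
    using vertex_exists by metis
  have "\<exists>R \<subseteq> set (List.enumerate k (letters w)).
      \<forall>p\<in>K. fa_eval (step_matrix e R) p $ a $ b = 0 \<longrightarrow> p = 0"
  proof (cases "K \<subseteq> {0}")
    case True
    then show ?thesis
      by blast
  next
    case False
    then obtain q where q: "q \<in> K" "q \<noteq> 0"
      by blast
    then have q_coeff: "Poly_Mapping.lookup q w \<noteq> 0"
      using K_coeff by blast
    have "q \<in> W"
      using q(1) by (simp add: K_def)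
    then obtain R where R: "R \<subseteq> set (List.enumerate k (letters w))"
      "fa_eval (step_matrix e R) q $ a $ b \<noteq> 0"
      using coeff_zero_if_segment_entries_zero[of q w k a b] q_coeff deg[of q] bound a b
      by (auto simp: l_def)
    have "p = 0" if p: "p \<in> K" "fa_eval (step_matrix e R) p $ a $ b = 0" for p
    proof -
      define c where "c = Poly_Mapping.lookup p w / Poly_Mapping.lookup q w"
      have "p - fa_scale c q \<in> K"
        using K p(1) q(1) by (intro fa.subspace_diff fa.subspace_scale)
      then have "p - fa_scale c q = 0"
        using q_coeff by (intro K_coeff) (auto simp: lookup_minus c_def)
      then have "p = fa_scale c q"
        by simp
      then show ?thesis
        using p(2) R(2) by (simp add: fa_eval_scale mat_scale_def)
    qed
    then show ?thesis
      using R(1) by blast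
  qed
  then obtain R where R: "R \<subseteq> set (List.enumerate k (letters w))"
    and R_sep: "\<And>p. p \<in> K \<Longrightarrow> fa_eval (step_matrix e R) p $ a $ b = 0 \<Longrightarrow> p = 0"
    by blast
  have R': "finite R" "\<forall>s\<in>R. k \<le> fst s \<and> fst s < k + l"
    using R finite_subset[OF R finite_set] by (auto simp: in_set_enumerate_eq l_def)
  have R_bound: "\<forall>s\<in>R. fst s + 1 < 2 * CARD('s)"
    using R'(2) bound by fastforce
  show ?case
  proof (intro exI[of _ "R \<union> T"] conjI ballI impI)
    show "finite (R \<union> T)"
      using R' T by simp
    show "k \<le> fst s" "fst s + 1 < 2 * CARD('s)" if "s \<in> R \<union> T" for s
      using that R' R_bound T by fastforce+
    fix p
    assume "p \<in> W" and p: "\<forall>a b. k div 2 \<le> e a \<longrightarrow> fa_eval (step_matrix e (R \<union> T)) p $ a $ b = 0"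
    have "fa_eval (step_matrix e T) p $ a' $ b' = 0" if a': "(k + l + 1) div 2 \<le> e a'" for a' b'
    proof -
      have "set ss \<subseteq> T \<longleftrightarrow> set ss \<subseteq> R \<union> T" if "walk (e a') ss (e b')" for ss
      proof -
        have "s \<notin> R" if "s \<in> set ss" for s
          using walk_step_bounds(1)[OF \<open>walk _ ss _\<close> that] a' R'(2) by fastforce
        then show ?thesis
          by blast
      qed
      then have "fa_eval (step_matrix e T) p $ a' $ b' = fa_eval (step_matrix e (R \<union> T)) p $ a' $ b'"
        using R' R_bound T by (intro fa_eval_step_matrix_cong) auto
      moreover have "k div 2 \<le> e a'"
        using a' by linarith
      ultimately show ?thesis
        using p by simp
    qed
    then have "p \<in> K"
      using \<open>p \<in> W\<close> by (simp add: K_def)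
    moreover have "fa_eval (step_matrix e R) p $ a $ b = 0"
    proof -
      have "set ss \<subseteq> R \<longleftrightarrow> set ss \<subseteq> R \<union> T" if "walk (e a) ss (e b)" for ss
      proof -
        have "s \<notin> T" if "s \<in> set ss" for s
          using walk_step_bounds(2)[OF \<open>walk _ ss _\<close> that] b T(2) by fastforce
        then show ?thesis
          by blast
      qed
      then have "fa_eval (step_matrix e R) p $ a $ b = fa_eval (step_matrix e (R \<union> T)) p $ a $ b"
        using R' R_bound T by (intro fa_eval_step_matrix_cong) auto
      then show ?thesis
        using p a by simp
    qed
    ultimately show "p = 0"
      by (rule R_sep)
  qed
qed

end

theorem corollary3p5:
  fixes f :: "nat \<Rightarrow> ('n::finite, 'a::field) free_algebra"
    and m :: nat
  assumes "m \<ge> 1"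
    and "locally_dependent TYPE('s::finite) {1..m} f"
    and "real CARD('s) > 1 / 2 * ((\<Sum>j=1..m. real (fa_degree (f j))) + real m - 1)"
  shows "family_dependent fa_scale {1..m} f"
proof -
  obtain e :: "'s \<Rightarrow> nat" where e: "bij_betw e UNIV {..<CARD('s)}"
    using ex_bij_betw_finite_nat[of "UNIV :: 's set"] by (auto simp: atLeast0LessThan)
  let ?W = "fa.span (f ` {1..m})"
  obtain ws where ws: "leading_words ws ?W"
    "(\<Sum>w\<leftarrow>ws. length (letters w) + 1) \<le> (\<Sum>j=1..m. fa_degree (f j) + 1)"
    using leading_words_span[of "{1..m}" f] by auto
  have "real ((\<Sum>j=1..m. fa_degree (f j)) + m) < real (2 * CARD('s) + 1)"
    using assms(3) by simp
  then have "(\<Sum>j=1..m. fa_degree (f j) + 1) \<le> 2 * CARD('s)"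
    unfolding of_nat_less_iff sum.distrib by simp
  with ws(2) have "0 + (\<Sum>w\<leftarrow>ws. length (letters w) + 1) \<le> 2 * CARD('s)"
    by linarith
  from separating_steps_exist[OF e fa.subspace_span ws(1) this] obtain S where
    sep: "\<forall>p\<in>?W. (\<forall>a b. 0 div 2 \<le> e a \<longrightarrow> fa_eval (step_matrix e S) p $ a $ b = 0) \<longrightarrow> p = 0"
    by (elim exE conjE)
  obtain \<alpha> where \<alpha>: "\<exists>j\<in>{1..m}. \<alpha> j \<noteq> 0"
    "(\<Sum>j=1..m. mat_scale (\<alpha> j) (fa_eval (step_matrix e S :: 'n \<Rightarrow> 'a ^ 's ^ 's) (f j))) = 0"
    using assms(2) unfolding locally_dependent_def family_dependent_def by blast
  let ?p = "\<Sum>j=1..m. fa_scale (\<alpha> j) (f j)"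
  have "?p \<in> ?W"
    by (intro fa.span_sum fa.span_scale fa.span_base) auto
  moreover have "fa_eval (step_matrix e S :: 'n \<Rightarrow> 'a ^ 's ^ 's) ?p = 0"
    using \<alpha>(2) by (simp add: fa_eval_sum fa_eval_scale)
  ultimately have "?p = 0"
    using bspec[OF sep, of ?p] by simp
  then show ?thesis
    using \<alpha>(1) unfolding family_dependent_def by blast
qed

end
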